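(* Let $k > \ell \geq 1$ be integers, let $i = i(k,\ell)$, and let $e_1,\dots,e_t$ be positive integers. Then \[ R_<\big(P_{e_1}^{k,\ell}, \dots, P_{e_t}^{k,\ell}\big) = (k-\ell)\,R_<\big(P_{e_1}^{i,i-1}, \dots, P_{e_t}^{i,i-1}\big) + \ell - (k-\ell)(i-1). \]
   Context: An ordered $k$-uniform hypergraph is a $k$-uniform hypergraph with a totally ordered vertex set. An ordered hypergraph $G$ is contained in an ordered hypergraph $H$ if there is an injective order-preserving map $V(G)\to V(H)$ sending every edge of $G$ to an edge of $H$. $K_N^k$ is the complete $k$-uniform hypergraph on $[N]=\{1,\dots,N\}$ with the natural order. For ordered $k$-uniform hypergraphs $G_1,\dots,G_t$, the ordered Ramsey number $R_<(G_1,\dots,G_t)$ is the least $N$ such that for every coloring $c:E(K_N^k)\to[t]$ there is a color $j$ such that the hypergraph formed by the edges of color $j$ contains $G_j$. For integers $k>\ell\ge 0$ and $e\ge1$, the path $P_e^{k,\ell}$ is the ordered $k$-uniform hypergraph on vertex set $[e(k-\ell)+\ell]$ with edges $A_r=\{(r-1)(k-\ell)+1,\dots,(r-1)(k-\ell)+k\}$ for $r=1,\dots,e$ (so consecutive edges share exactly $\ell$ vertices: the $\ell$ largest of $A_r$ and the $\ell$ smallest of $A_{r+1}$). For $k>\ell\ge1$, the intersection number $i(k,\ell)$ is the unique integer $m\ge2$ with $\frac{m-2}{m-1}<\frac{\ell}{k}\le\frac{m-1}{m}$. *)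

theory Defs
  imports Complex_Main "HOL-Library.Ramsey"
begin

text \<open>
  The order of the vertices is the one of their type: \<open>'a\<close> is always a linear order below.
\<close>

record 'a hypergraph =
  verts :: "'a set"
  edges :: "'a set set"

definition uniform_hypergraph :: "nat \<Rightarrow> 'a hypergraph \<Rightarrow> bool" where
  "uniform_hypergraph k H \<longleftrightarrow> finite (verts H) \<and> edges H \<subseteq> [verts H]\<^bsup>k\<^esup>"

definition contained_in :: "'a::linorder hypergraph \<Rightarrow> 'b::linorder hypergraph \<Rightarrow> bool" where
  "contained_in G H \<longleftrightarrow>
     (\<exists>f \<in> verts G \<rightarrow> verts H. inj_on f (verts G) \<and> mono_on (verts G) f \<and>
        (\<forall>A \<in> edges G. f ` A \<in> edges H))"

definition complete_hypergraph :: "nat \<Rightarrow> nat \<Rightarrow> nat hypergraph" where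
  "complete_hypergraph k N = \<lparr>verts = {1..N}, edges = [{1..N}]\<^bsup>k\<^esup>\<rparr>"

definition color_class :: "'a hypergraph \<Rightarrow> ('a set \<Rightarrow> nat) \<Rightarrow> nat \<Rightarrow> 'a hypergraph" where
  "color_class H c j = \<lparr>verts = verts H, edges = {A \<in> edges H. c A = j}\<rparr>"

text \<open>
  The \<open>t\<close> target hypergraphs are \<open>G 1, \<dots>, G t\<close>; other values of \<open>G\<close> are irrelevant.
  The least \<open>N\<close> exists by Ramsey's theorem when they are \<open>k\<close>-uniform.
\<close>

definition ordered_ramsey :: "nat \<Rightarrow> nat \<Rightarrow> (nat \<Rightarrow> 'a::linorder hypergraph) \<Rightarrow> nat" where
  "ordered_ramsey k t G =
     (LEAST N. \<forall>c \<in> edges (complete_hypergraph k N) \<rightarrow> {1..t}.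
        \<exists>j \<in> {1..t}. contained_in (G j) (color_class (complete_hypergraph k N) c j))"

definition path_edge :: "nat \<Rightarrow> nat \<Rightarrow> nat \<Rightarrow> nat set" where
  "path_edge k l r = {(r - 1) * (k - l) + 1 .. (r - 1) * (k - l) + k}"

definition path_hypergraph :: "nat \<Rightarrow> nat \<Rightarrow> nat \<Rightarrow> nat hypergraph" where
  "path_hypergraph k l e = \<lparr>verts = {1 .. e * (k - l) + l}, edges = path_edge k l ` {1..e}\<rparr>"

definition is_intersection_number :: "nat \<Rightarrow> nat \<Rightarrow> nat \<Rightarrow> bool" where
  "is_intersection_number k l m \<longleftrightarrow>
     2 \<le> m \<and> (real m - 2) / (real m - 1) < real l / real k \<and> real l / real k \<le> (real m - 1) / real m"

definition intersection_number :: "nat \<Rightarrow> nat \<Rightarrow> nat" where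
  "intersection_number k l = (THE m. is_intersection_number k l m)"

lemma uniform_complete_hypergraph: "uniform_hypergraph k (complete_hypergraph k N)"
  by (simp add: uniform_hypergraph_def complete_hypergraph_def)

lemma uniform_color_class:
  "uniform_hypergraph k H \<Longrightarrow> uniform_hypergraph k (color_class H c j)"
  by (auto simp: uniform_hypergraph_def color_class_def)

lemma uniform_path_hypergraph:
  assumes "l < k"
  shows "uniform_hypergraph k (path_hypergraph k l e)"
proof -
  have "path_edge k l r \<in> [{1 .. e * (k - l) + l}]\<^bsup>k\<^esup>" if r: "r \<in> {1..e}" for r
  proof -
    have "(r - 1) * (k - l) + k = r * (k - l) + l"
      using r assms by (cases r) auto
    also have "\<dots> \<le> e * (k - l) + l"
      using r by simp
    finally show ?thesis
      unfolding path_edge_def nsets_def by auto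
  qed
  then show ?thesis
    by (auto simp: uniform_hypergraph_def path_hypergraph_def)
qed

lemma is_intersection_number_iff:
  assumes "l < k"
  shows "is_intersection_number k l m \<longleftrightarrow> 2 \<le> m \<and> (m - 1) * (k - l) < k \<and> k \<le> m * (k - l)"
proof (cases "2 \<le> m")
  case True
  have k: "real k > 0" and m: "real m - 1 > 0" "real m > 0"
    using assms True by auto
  have "(real m - 2) / (real m - 1) < real l / real k \<longleftrightarrow> (real m - 1) * (real k - real l) < real k"
    using k m by (simp add: divide_simps) (simp add: algebra_simps)
  also have "\<dots> \<longleftrightarrow> real ((m - 1) * (k - l)) < real k"
    using assms True by (simp add: of_nat_diff)
  finally have 1: "(real m - 2) / (real m - 1) < real l / real k \<longleftrightarrow> (m - 1) * (k - l) < k"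
    by (simp only: of_nat_less_iff)
  have "real l / real k \<le> (real m - 1) / real m \<longleftrightarrow> real k \<le> real m * (real k - real l)"
    using k m by (simp add: divide_simps) (simp add: algebra_simps)
  also have "\<dots> \<longleftrightarrow> real k \<le> real (m * (k - l))"
    using assms by (simp add: of_nat_diff)
  finally have 2: "real l / real k \<le> (real m - 1) / real m \<longleftrightarrow> k \<le> m * (k - l)"
    by (simp only: of_nat_le_iff)
  from 1 2 True show ?thesis
    by (simp add: is_intersection_number_def)
qed (simp add: is_intersection_number_def)

lemma ex1_intersection_number:
  assumes "1 \<le> l" "l < k"
  shows "\<exists>!m. is_intersection_number k l m"
proof (rule ex_ex1I)
  define m where "m = (LEAST m. k \<le> m * (k - l))"
  have "k \<le> k * (k - l)"
    using assms by simp
  then have le: "k \<le> m * (k - l)"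
    unfolding m_def by (rule LeastI)
  have "2 \<le> m"
  proof (rule ccontr)
    assume "\<not> 2 \<le> m"
    then have "m * (k - l) \<le> 1 * (k - l)"
      by (intro mult_le_mono1) simp
    with le have "k \<le> 1 * (k - l)"
      by (rule order_trans)
    with assms show False
      by simp
  qed
  moreover from this have "\<not> k \<le> (m - 1) * (k - l)"
    unfolding m_def by (intro not_less_Least) simp
  ultimately show "\<exists>m. is_intersection_number k l m"
    using le is_intersection_number_iff[OF assms(2)] by (auto simp: not_le)
next
  fix m n
  have *: "a \<le> b" if "is_intersection_number k l a" "is_intersection_number k l b" for a b
  proof -
    have "(a - 1) * (k - l) < b * (k - l)"
      using that is_intersection_number_iff[OF assms(2)] by (meson less_le_trans)
    then have "a - 1 < b"
      by simp
    then show ?thesis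
      by linarith
  qed
  assume "is_intersection_number k l m" "is_intersection_number k l n"
  then show "m = n"
    using * by (blast intro: antisym)
qed

end

theory Submission
  imports Defs
begin

text \<open>
  Put \<open>d = k - l\<close> and \<open>i = p + 1\<close>, so that \<open>k = p * d + s\<close> with \<open>1 \<le> s \<le> d\<close>. If \<open>M\<close> is the
  Ramsey number of the paths \<open>P\<^sup>i\<^sup>,\<^sup>i\<^sup>-\<^sup>1\<close>, then the claim reads \<open>R = (M - 1) * d + s\<close>.

  Upper bound: cut \<open>{1..(M - 1) * d + s}\<close> into \<open>M - 1\<close> blocks of size \<open>d\<close> followed by one of size
  \<open>s\<close>, and give an \<open>i\<close>-subset of \<open>{1..M}\<close> the colour of the \<open>k\<close>-set formed by its first \<open>p\<close>
  blocks and the first \<open>s\<close> vertices of its last block.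

  Lower bound: from a colouring of the \<open>i\<close>-subsets of \<open>{1..M - 1}\<close> colour a \<open>k\<close>-set
  \<open>x\<^sub>1 < \<dots> < x\<^sub>k\<close> by the colour of the images of \<open>x\<^sub>s, x\<^sub>s\<^sub>+\<^sub>d, \<dots>, x\<^sub>k\<close> under
  \<open>x \<mapsto> (x - s) div d + 1\<close>, which separates numbers at distance at least \<open>d\<close>.
\<close>

section \<open>Increasing maps between initial segments of the positive integers\<close>

text \<open>Values outside \<open>{1..n}\<close> are left free, so that windows of a map are plain
  shifts; agreement on an initial segment is handled by the \<open>cong\<close> lemmas.\<close>

definition embeddings :: "nat \<Rightarrow> nat \<Rightarrow> (nat \<Rightarrow> nat) set" where
  "embeddings n N = {f. strict_mono_on {1..n} f \<and> f \<in> {1..n} \<rightarrow> {1..N}}"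

lemma embeddingsI:
  assumes "\<And>x y. 1 \<le> x \<Longrightarrow> x < y \<Longrightarrow> y \<le> n \<Longrightarrow> f x < f y"
    and "\<And>x. 1 \<le> x \<Longrightarrow> x \<le> n \<Longrightarrow> 1 \<le> f x \<and> f x \<le> N"
  shows "f \<in> embeddings n N"
  unfolding embeddings_def mem_Collect_eq
proof (intro conjI strict_mono_onI Pi_I)
  show "f x < f y" if "x \<in> {1..n}" "y \<in> {1..n}" "x < y" for x y
    using that assms(1)[of x y] by simp
  show "f x \<in> {1..N}" if "x \<in> {1..n}" for x
    using that assms(2)[of x] by simp
qed

lemma embeddings_less: "f \<in> embeddings n N \<Longrightarrow> 1 \<le> x \<Longrightarrow> x < y \<Longrightarrow> y \<le> n \<Longrightarrow> f x < f y"
  by (auto simp: embeddings_def strict_mono_on_def)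

lemma embeddings_range: "f \<in> embeddings n N \<Longrightarrow> 1 \<le> x \<Longrightarrow> x \<le> n \<Longrightarrow> 1 \<le> f x \<and> f x \<le> N"
  by (auto simp: embeddings_def)

lemma embeddings_shift:
  assumes "f \<in> embeddings m N" "r + n \<le> m"
  shows "(\<lambda>x. f (r + x)) \<in> embeddings n N"
proof (rule embeddingsI)
  show "f (r + x) < f (r + y)" if "1 \<le> x" "x < y" "y \<le> n" for x y
    using embeddings_less[OF assms(1), of "r + x" "r + y"] assms(2) that by auto
  show "1 \<le> f (r + x) \<and> f (r + x) \<le> N" if "1 \<le> x" "x \<le> n" for x
    using embeddings_range[OF assms(1), of "r + x"] assms(2) that by auto
qed

lemma embeddings_image:
  assumes "f \<in> embeddings n N"
  shows "f ` {1..n} \<in> [{1..N}]\<^bsup>n\<^esup>"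
proof -
  have "inj_on f {1..n}"
    using assms by (simp add: embeddings_def strict_mono_on_imp_inj_on)
  then show ?thesis
    using assms by (auto simp: embeddings_def nsets_def card_image)
qed

text \<open>Integers grow by at least one per step. This makes \<open>h q - q\<close> monotone for
  \<open>blowup\<close>, and keeps samples \<open>d\<close> positions apart at distance at least
  \<open>d\<close> for \<open>thinning\<close>.\<close>

lemma embeddings_gap:
  assumes "f \<in> embeddings n N" "1 \<le> x" "x \<le> y" "y \<le> n"
  shows "f x + (y - x) \<le> f y"
  using \<open>x \<le> y\<close> \<open>y \<le> n\<close>
proof (induction y rule: dec_induct)
  case (step y)
  then show ?case
    using embeddings_less[OF assms(1), of y "Suc y"] assms(2) by auto
qed simp

text \<open>This keeps truncated differences such as \<open>h q - q\<close> exact.\<close>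

lemma embeddings_ge:
  assumes "f \<in> embeddings n N" "1 \<le> x" "x \<le> n"
  shows "x \<le> f x"
proof -
  have "f 1 + (x - 1) \<le> f x"
    using assms by (intro embeddings_gap) auto
  moreover have "1 \<le> f 1"
    using embeddings_range[OF assms(1), of 1] assms(2,3) by simp
  ultimately show ?thesis
    by linarith
qed

definition kth :: "nat set \<Rightarrow> nat \<Rightarrow> nat" where
  "kth A n = sorted_list_of_set A ! (n - 1)"

lemma kth_embedding:
  assumes "A \<in> [{1..N}]\<^bsup>k\<^esup>"
  shows "kth A \<in> embeddings k N"
proof (rule embeddingsI)
  have A: "finite A" "card A = k" "A \<subseteq> {1..N}"
    using assms by (auto simp: nsets_def)
  let ?xs = "sorted_list_of_set A"
  have len: "length ?xs = k"
    using A by simp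
  show "kth A x < kth A y" if "1 \<le> x" "x < y" "y \<le> k" for x y
    unfolding kth_def using that len
    by (intro sorted_wrt_nth_less[of "(<)"]) auto
  show "1 \<le> kth A x \<and> kth A x \<le> N" if "1 \<le> x" "x \<le> k" for x
  proof -
    have "kth A x \<in> set ?xs"
      unfolding kth_def using that len by (intro nth_mem) auto
    then show ?thesis
      using A by auto
  qed
qed

text \<open>An increasing map is recovered from its image, so a colouring of sets can be defined
  through the maps enumerating them.\<close>

lemma kth_image:
  assumes "f \<in> embeddings k N" "1 \<le> n" "n \<le> k"
  shows "kth (f ` {1..k}) n = f n"
proof -
  have "sorted_list_of_set (f ` {1..k}) = map f [1..<Suc k]"
  proof -
    have "sorted_wrt (<) (map f [1..<Suc k])"
      using embeddings_less[OF assms(1)]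
      by (auto simp: sorted_wrt_iff_nth_less simp del: upt_Suc)
    then have "sorted_list_of_set (set (map f [1..<Suc k])) = map f [1..<Suc k]"
      by (metis sorted_list_of_set.idem_if_sorted_distinct strict_sorted_iff)
    moreover have "set (map f [1..<Suc k]) = f ` {1..k}"
      by (simp only: set_map set_upt atLeastLessThanSuc_atLeastAtMost)
    ultimately show ?thesis
      by metis
  qed
  then show ?thesis
    using assms by (simp add: kth_def del: upt_Suc)
qed

section \<open>The partition relation for paths\<close>

text \<open>\<open>ordered_ramsey k t G\<close> is the least \<open>N\<close> with this
  property.\<close>

definition arrows :: "nat \<Rightarrow> nat \<Rightarrow> (nat \<Rightarrow> 'a::linorder hypergraph) \<Rightarrow> nat \<Rightarrow> bool" where
  "arrows k t G N \<longleftrightarrow> (\<forall>c \<in> edges (complete_hypergraph k N) \<rightarrow> {1..t}.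
     \<exists>j \<in> {1..t}. contained_in (G j) (color_class (complete_hypergraph k N) c j))"

text \<open>Edge \<open>Suc r\<close> is \<open>{1..k}\<close> shifted by
  \<open>r * (k - l)\<close>, so a copy of the path is an embedding whose windows all have colour
  \<open>j\<close>; each window is automatically a \<open>k\<close>-subset of
  \<open>{1..N}\<close>.\<close>

lemma path_contained_in_iff:
  assumes "l < k"
  shows "contained_in (path_hypergraph k l e) (color_class (complete_hypergraph k N) c j) \<longleftrightarrow>
    (\<exists>f \<in> embeddings (e * (k - l) + l) N. \<forall>r < e. c ((\<lambda>x. f (r * (k - l) + x)) ` {1..k}) = j)"
    (is "?L \<longleftrightarrow> (\<exists>f \<in> ?E. ?R f)")
proof -
  let ?m = "e * (k - l) + l"
  have emb: "f \<in> ?E \<longleftrightarrow> f \<in> {1..?m} \<rightarrow> {1..N} \<and> inj_on f {1..?m} \<and> mono_on {1..?m} f" for f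
    by (auto simp: embeddings_def strict_mono_iff_mono)
  have img: "f ` path_edge k l (Suc r) = (\<lambda>x. f (r * (k - l) + x)) ` {1..k}"
    for f :: "nat \<Rightarrow> nat" and r
  proof -
    have "path_edge k l (Suc r) = (\<lambda>x. r * (k - l) + x) ` {1..k}"
      by (simp add: path_edge_def)
    then show ?thesis
      by (simp only: image_image)
  qed
  have nset: "(\<lambda>x. f (r * (k - l) + x)) ` {1..k} \<in> [{1..N}]\<^bsup>k\<^esup>" 
    if "f \<in> ?E" "r < e" for f r
  proof (rule embeddings_image, rule embeddings_shift[OF \<open>f \<in> ?E\<close>])
    have "Suc r * (k - l) \<le> e * (k - l)"
      using \<open>r < e\<close> by (intro mult_le_mono1) simp
    then show "r * (k - l) + k \<le> ?m"
      using assms by simp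
  qed
  have range: "(\<forall>r \<in> {Suc 0..e}. Q r) \<longleftrightarrow> (\<forall>r < e. Q (Suc r))" for Q
  proof -
    have "{Suc 0..e} = Suc ` {..<e}"
      by (simp add: image_Suc_lessThan)
    then show ?thesis
      by auto
  qed
  have "?L \<longleftrightarrow> (\<exists>f \<in> ?E. \<forall>r < e. f ` path_edge k l (Suc r) \<in> [{1..N}]\<^bsup>k\<^esup> \<and> c (f ` path_edge k l (Suc r)) = j)"
    unfolding contained_in_def path_hypergraph_def color_class_def complete_hypergraph_def
    by (simp add: range emb Bex_def conj_assoc del: image_eqI)
  then show ?thesis
    unfolding img using nset by blast
qed

lemma arrows_path_iff:
  assumes "l < k"
  shows "arrows k t (\<lambda>j. path_hypergraph k l (e j)) N \<longleftrightarrow>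
    (\<forall>c \<in> [{1..N}]\<^bsup>k\<^esup> \<rightarrow> {1..t}. \<exists>j \<in> {1..t}. \<exists>f \<in> embeddings (e j * (k - l) + l) N.
      \<forall>r < e j. c ((\<lambda>x. f (r * (k - l) + x)) ` {1..k}) = j)"
  unfolding arrows_def path_contained_in_iff[OF assms] by (simp add: complete_hypergraph_def)

text \<open>A monochromatic set with as many elements as the path has vertices contains the path, so
  Ramsey's theorem yields an \<open>N\<close> and the \<open>LEAST\<close> is attained.\<close>

lemma arrows_path_exists:
  assumes "l < k"
  shows "\<exists>N. arrows k t (\<lambda>j. path_hypergraph k l (e j)) N"
proof -
  \<comment> \<open>For \<open>partn_lst\<close> vertices and colours are numbered from 0 here:
    entry \<open>j\<close> belongs to colour \<open>Suc j\<close>.\<close>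
  define qs where "qs = map (\<lambda>j. e (Suc j) * (k - l) + l) [0..<t]"
  obtain N :: nat where N: "partn_lst {..<N} qs k"
    using ramsey_full by blast
  have "arrows k t (\<lambda>j. path_hypergraph k l (e j)) N"
    unfolding arrows_path_iff[OF assms]
  proof
    fix c assume c: "c \<in> [{1..N}]\<^bsup>k\<^esup> \<rightarrow> {1..t}"
    have Suc_nsets: "Suc ` A \<in> [{1..N}]\<^bsup>n\<^esup>" if "A \<in> [{..<N}]\<^bsup>n\<^esup>" for A n
      using that by (auto simp: nsets_def card_image)
    have "(\<lambda>A. c (Suc ` A) - 1) \<in> [{..<N}]\<^bsup>k\<^esup> \<rightarrow> {..<t}"
      using c Suc_nsets by (fastforce simp: Pi_iff)
    then obtain j H where j: "j < t" and H: "H \<in> [{..<N}]\<^bsup>(qs ! j)\<^esup>"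
      and mono: "(\<lambda>A. c (Suc ` A) - 1) ` [H]\<^bsup>k\<^esup> \<subseteq> {j}"
      by (rule partn_lstE[OF N]) (auto simp: qs_def)
    have qs: "qs ! j = e (Suc j) * (k - l) + l"
      using j by (simp add: qs_def)
    let ?f = "kth (Suc ` H)"
    have f: "?f \<in> embeddings (e (Suc j) * (k - l) + l) N"
      using kth_embedding[OF Suc_nsets[OF H]] qs by simp
    have "c ((\<lambda>x. ?f (r * (k - l) + x)) ` {1..k}) = Suc j" if "r < e (Suc j)" for r
    proof -
      let ?B = "(\<lambda>x. ?f (r * (k - l) + x)) ` {1..k}"
      have "Suc r * (k - l) \<le> e (Suc j) * (k - l)"
        using that by (intro mult_le_mono1) simp
      then have le: "r * (k - l) + k \<le> e (Suc j) * (k - l) + l"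
        using assms by simp
      have B: "?B \<in> [{1..N}]\<^bsup>k\<^esup>"
        by (rule embeddings_image, rule embeddings_shift[OF f le])
      have "?B \<subseteq> Suc ` H"
      proof clarify
        fix x assume x: "x \<in> {1..k}"
        have fin: "finite (Suc ` H)" "card (Suc ` H) = e (Suc j) * (k - l) + l"
          using Suc_nsets[OF H] qs by (auto simp: nsets_def)
        then have "?f (r * (k - l) + x) \<in> set (sorted_list_of_set (Suc ` H))"
          unfolding kth_def using x le by (intro nth_mem) auto
        then show "?f (r * (k - l) + x) \<in> Suc ` H"
          using fin by simp
      qed
      then obtain A where A: "A \<subseteq> H" "?B = Suc ` A"
        by (auto simp: subset_image_iff)
      moreover have "A \<in> [H]\<^bsup>k\<^esup>"
        using A B by (auto simp: nsets_def card_image finite_image_iff)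
      ultimately have "c ?B - 1 = j"
        using mono by auto
      \<comment> \<open>Subtraction truncates, so for \<open>j = 0\<close> the colour 0 has to be
        excluded.\<close>
      moreover have "c ?B \<ge> 1"
        using c B by (auto simp: Pi_iff)
      ultimately show ?thesis
        by simp
    qed
    then show "\<exists>j \<in> {1..t}. \<exists>f \<in> embeddings (e j * (k - l) + l) N.
      \<forall>r < e j. c ((\<lambda>x. f (r * (k - l) + x)) ` {1..k}) = j"
      using f j by (intro bexI[of _ "Suc j"] bexI[of _ ?f]) auto
  qed
  then show ?thesis
    by blast
qed

text \<open>The path has a vertex, which cannot go into the empty set. Hence the least
  \<open>N\<close> is a successor.\<close>

lemma arrows_path_nonzero:
  assumes "l < k" "\<And>j. j \<in> {1..t} \<Longrightarrow> 1 \<le> e j"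
  shows "\<not> arrows k t (\<lambda>j. path_hypergraph k l (e j)) 0"
proof
  assume "arrows k t (\<lambda>j. path_hypergraph k l (e j)) 0"
  \<comment> \<open>As \<open>k > 0\<close>, the empty set has no \<open>k\<close>-subset and any
    function is a colouring, even for \<open>t = 0\<close>.\<close>
  moreover have "(\<lambda>_. 0) \<in> [{1..0::nat}]\<^bsup>k\<^esup> \<rightarrow> {1..t}"
    using assms(1) by (simp add: nsets_empty_iff)
  ultimately obtain j f where j: "j \<in> {1..t}" and f: "f \<in> embeddings (e j * (k - l) + l) 0"
    unfolding arrows_path_iff[OF assms(1)] by blast
  have "1 \<le> e j * (k - l) + l"
    using assms(1) assms(2)[OF j] by (simp add: Suc_le_eq)
  then show False
    using embeddings_range[OF f, of 1] by auto
qed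

section \<open>Blowing up vertices to blocks\<close>

text \<open>The vertex \<open>x\<close> of block \<open>q\<close> goes to the vertex at the same position in block \<open>h q\<close>.\<close>

definition blowup :: "nat \<Rightarrow> (nat \<Rightarrow> nat) \<Rightarrow> nat \<Rightarrow> nat" where
  "blowup d h x = x + (let q = Suc ((x - 1) div d) in (h q - q) * d)"

text \<open>The displacement \<open>h q - q\<close> never decreases with the block \<open>q\<close>,
  so adding \<open>d\<close> times it keeps the order strict; it is at most \<open>M - m\<close>,
  which bounds the values by \<open>M * d + s\<close>.\<close>

lemma blowup_embedding:
  assumes h: "h \<in> embeddings (Suc m) (Suc M)" and "1 \<le> s" "s \<le> d"
  shows "blowup d h \<in> embeddings (m * d + s) (M * d + s)"
proof (rule embeddingsI)
  have q_le: "Suc ((x - 1) div d) \<le> Suc m" if "1 \<le> x" "x \<le> m * d + s" for x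
  proof -
    have "x - 1 < Suc m * d"
      using that assms by auto
    then show ?thesis
      by (metis Suc_leI less_mult_imp_div_less)
  qed
  show "blowup d h x < blowup d h y" if xy: "1 \<le> x" "x < y" "y \<le> m * d + s" for x y
  proof -
    let ?p = "Suc ((x - 1) div d)" and ?q = "Suc ((y - 1) div d)"
    have "?p \<le> ?q"
      using xy by (simp add: div_le_mono)
    then have "h ?p + (?q - ?p) \<le> h ?q"
      using xy by (intro embeddings_gap[OF h] q_le) auto
    moreover have "?p \<le> h ?p"
      using embeddings_ge[OF h _ q_le[of x]] xy by simp
    ultimately have "h ?p - ?p \<le> h ?q - ?q"
      using \<open>?p \<le> ?q\<close> by linarith
    then have "(h ?p - ?p) * d \<le> (h ?q - ?q) * d"
      by (rule mult_le_mono1)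
    then show ?thesis
      using xy unfolding blowup_def Let_def by linarith
  qed
  show "1 \<le> blowup d h x \<and> blowup d h x \<le> M * d + s" if x: "1 \<le> x" "x \<le> m * d + s" for x
  proof -
    let ?q = "Suc ((x - 1) div d)"
    have "h ?q + (Suc m - ?q) \<le> h (Suc m)"
      using q_le[OF x] by (intro embeddings_gap[OF h]) auto
    also have "h (Suc m) \<le> Suc M"
      using embeddings_range[OF h, of "Suc m"] by simp
    finally have "h ?q - ?q \<le> M - m"
      using q_le[OF x] by linarith
    have "m \<le> M"
      using embeddings_ge[OF h, of "Suc m"] embeddings_range[OF h, of "Suc m"] by simp
    have "(h ?q - ?q) * d \<le> (M - m) * d"
      using \<open>h ?q - ?q \<le> M - m\<close> by (intro mult_le_mono1)
    then have "blowup d h x \<le> x + (M - m) * d"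
      by (simp add: blowup_def Let_def)
    also have "\<dots> \<le> m * d + s + (M - m) * d"
      using x by simp
    also have "\<dots> = M * d + s"
      using \<open>m \<le> M\<close> by (simp add: diff_mult_distrib)
    finally show ?thesis
      using x by (simp add: blowup_def)
  qed
qed

lemma blowup_cong:
  assumes "\<And>q. 1 \<le> q \<Longrightarrow> q \<le> Suc m \<Longrightarrow> h q = h' q" "1 \<le> x" "x \<le> m * d + s" "s \<le> d"
  shows "blowup d h x = blowup d h' x"
proof -
  have "x - 1 < Suc m * d"
    using assms by auto
  then have "Suc ((x - 1) div d) \<le> Suc m"
    by (metis Suc_leI less_mult_imp_div_less)
  then show ?thesis
    using assms(1)[of "Suc ((x - 1) div d)"] by (simp add: blowup_def Let_def)
qed

text \<open>Adding \<open>r * d\<close> skips \<open>r\<close> whole blocks and keeps the position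
  inside the block, so window \<open>r\<close> of the blow-up is the blow-up of window
  \<open>r\<close> of \<open>h\<close>.\<close>

lemma blowup_shift:
  assumes h: "h \<in> embeddings m N" and r: "r + Suc p \<le> m"
    and x: "1 \<le> x" "x \<le> p * d + s" and s: "1 \<le> s" "s \<le> d"
  shows "blowup d h (r * d + x) = blowup d (\<lambda>q. h (r + q)) x"
proof -
  let ?q = "Suc ((x - 1) div d)"
  have "x - 1 < Suc p * d"
    using x s by auto
  then have "?q \<le> Suc p"
    by (metis Suc_leI less_mult_imp_div_less)
  then have ge: "r + ?q \<le> h (r + ?q)"
    using embeddings_ge[OF h, of "r + ?q"] r by simp
  have "r * d + x - 1 = (x - 1) + r * d"
    using x by simp
  then have "Suc ((r * d + x - 1) div d) = r + ?q"
    using s by (simp add: div_mult_self1)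
  then have "blowup d h (r * d + x) = r * d + x + (h (r + ?q) - (r + ?q)) * d"
    by (simp add: blowup_def Let_def)
  also have "\<dots> = x + (r + (h (r + ?q) - (r + ?q))) * d"
    by (simp add: algebra_simps)
  also have "r + (h (r + ?q) - (r + ?q)) = h (r + ?q) - ?q"
    using ge by linarith
  finally show ?thesis
    by (simp add: blowup_def Let_def)
qed

section \<open>Thinning maps by sampling every \<open>d\<close>-th position\<close>

text \<open>For an embedding \<open>f\<close>, sampling from position \<open>s\<close> on gives
  values at least \<open>s\<close>; those below \<open>M * d + s\<close> then fill exactly
  \<open>M\<close> intervals of length \<open>d\<close>.\<close>

definition thinning :: "nat \<Rightarrow> nat \<Rightarrow> (nat \<Rightarrow> nat) \<Rightarrow> nat \<Rightarrow> nat" where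
  "thinning d s f n = Suc ((f ((n - 1) * d + s) - s) div d)"

lemma thinning_embedding:
  assumes f: "f \<in> embeddings (m * d + s) N" and N: "N < M * d + s" and s: "1 \<le> s" "s \<le> d"
  shows "thinning d s f \<in> embeddings (Suc m) M"
proof (rule embeddingsI)
  have le: "(n - 1) * d + s \<le> m * d + s" if "n \<le> Suc m" for n
    using that by (intro add_right_mono mult_le_mono1) simp
  have ge: "s \<le> f ((n - 1) * d + s)" if "n \<le> Suc m" for n
  proof -
    have "(n - 1) * d + s \<le> f ((n - 1) * d + s)"
      using s by (intro embeddings_ge[OF f _ le[OF that]]) simp
    then show ?thesis
      by simp
  qed
  show "thinning d s f x < thinning d s f y" if xy: "1 \<le> x" "x < y" "y \<le> Suc m" for x y
  proof -
    have "Suc (x - 1) * d \<le> (y - 1) * d"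
      using xy by (intro mult_le_mono1) simp
    then have *: "(x - 1) * d + s + d \<le> (y - 1) * d + s"
      by simp
    then have "f ((x - 1) * d + s) + d \<le> f ((y - 1) * d + s)"
    proof -
      have "f ((x - 1) * d + s) + ((y - 1) * d + s - ((x - 1) * d + s)) \<le> f ((y - 1) * d + s)"
        using xy s * by (intro embeddings_gap[OF f] le) auto
      then show ?thesis
        using * by linarith
    qed
    then have "(f ((x - 1) * d + s) - s) + d \<le> f ((y - 1) * d + s) - s"
      using ge[of x] xy by simp
    then have "((f ((x - 1) * d + s) - s) + d) div d \<le> (f ((y - 1) * d + s) - s) div d"
      by (rule div_le_mono)
    then show ?thesis
      using s by (simp add: thinning_def)
  qed
  show "1 \<le> thinning d s f x \<and> thinning d s f x \<le> M" if x: "1 \<le> x" "x \<le> Suc m" for x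
  proof -
    have "f ((x - 1) * d + s) \<le> N"
      using embeddings_range[OF f _ le[of x]] x s by simp
    then have "f ((x - 1) * d + s) - s < M * d"
      using N ge[OF x(2)] s by linarith
    then have "(f ((x - 1) * d + s) - s) div d < M"
      by (rule less_mult_imp_div_less)
    then show ?thesis
      by (simp add: thinning_def)
  qed
qed

lemma thinning_cong:
  assumes "\<And>x. 1 \<le> x \<Longrightarrow> x \<le> m * d + s \<Longrightarrow> f x = f' x" "n \<le> Suc m" "1 \<le> s"
  shows "thinning d s f n = thinning d s f' n"
proof -
  have "(n - 1) * d + s \<le> m * d + s"
    using assms by (intro add_right_mono mult_le_mono1) simp
  then show ?thesis
    using assms by (simp add: thinning_def)
qed

text \<open>Moving by \<open>r\<close> samples is moving by \<open>r * d\<close> positions, so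
  thinning maps windows to windows.\<close>

lemma thinning_shift:
  assumes "1 \<le> n"
  shows "thinning d s f (r + n) = thinning d s (\<lambda>x. f (r * d + x)) n"
proof -
  have "(r + n - 1) * d = r * d + (n - 1) * d"
    using assms by (metis Nat.add_diff_assoc add_mult_distrib)
  then show ?thesis
    by (simp add: thinning_def add.assoc)
qed

section \<open>Transfer of the partition relation in both directions\<close>

text \<open>
  For \<open>k = p * d + s\<close> and \<open>l = k - d\<close> the path with \<open>e\<close> edges has \<open>(e + p - 1) * d + s\<close> vertices;
  for \<open>d = s = 1\<close> this is \<open>e + p\<close>.
\<close>

lemma arrows_blowup:
  assumes p: "1 \<le> p" and s: "1 \<le> s" "s \<le> d" and e: "\<And>j. j \<in> {1..t} \<Longrightarrow> 1 \<le> e j"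
    and arr: "arrows (Suc p) t (\<lambda>j. path_hypergraph (Suc p) p (e j)) (Suc M)"
  shows "arrows (p * d + s) t (\<lambda>j. path_hypergraph (p * d + s) ((p - 1) * d + s) (e j)) (M * d + s)"
proof -
  let ?k = "p * d + s" and ?l = "(p - 1) * d + s"
  have kl: "?l < ?k" "?k - ?l = d"
    using p s by (cases p; simp)+
  have len: "e j * d + ?l = (e j + p - 1) * d + s" for j
    using p by (cases p) (auto simp: algebra_simps)
  show ?thesis
    unfolding arrows_path_iff[OF kl(1)] kl(2)
  proof
    fix c assume c: "c \<in> [{1..M * d + s}]\<^bsup>?k\<^esup> \<rightarrow> {1..t}"
    define c' where "c' B = c (blowup d (kth B) ` {1..?k})" for B
    have "c' \<in> [{1..Suc M}]\<^bsup>Suc p\<^esup> \<rightarrow> {1..t}"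
    proof
      fix B assume "B \<in> [{1..Suc M}]\<^bsup>Suc p\<^esup>"
      then have "blowup d (kth B) ` {1..?k} \<in> [{1..M * d + s}]\<^bsup>?k\<^esup>"
        using s by (intro embeddings_image blowup_embedding kth_embedding)
      then show "c' B \<in> {1..t}"
        using c by (auto simp: c'_def)
    qed
    then obtain j h where j: "j \<in> {1..t}" and h: "h \<in> embeddings (e j + p) (Suc M)"
      and mono: "\<And>r. r < e j \<Longrightarrow> c' ((\<lambda>x. h (r + x)) ` {1..Suc p}) = j"
      using arr unfolding arrows_path_iff[OF lessI] by fastforce
    \<comment> \<open>The \<open>e j + p\<close> vertices found become \<open>e j + p - 1\<close>
      full blocks and a last one of size \<open>s\<close>.\<close>
    have ej: "Suc (e j + p - 1) = e j + p"
      using e[OF j] by simp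
    have "blowup d h \<in> embeddings (e j * d + ?l) (M * d + s)"
      unfolding len using h ej s by (intro blowup_embedding) simp_all
    moreover have "c ((\<lambda>x. blowup d h (r * d + x)) ` {1..?k}) = j" if r: "r < e j" for r
    proof -
      let ?h = "\<lambda>q. h (r + q)"
      have r': "r + Suc p \<le> e j + p"
        using r by simp
      \<comment> \<open>Edge \<open>r\<close> of the blown-up path is the set whose colour defines
        \<open>c'\<close> on window \<open>r\<close> of \<open>h\<close>: on the blocks read,
        \<open>kth\<close> returns \<open>?h\<close>.\<close>
      have "blowup d h (r * d + x) = blowup d (kth (?h ` {1..Suc p})) x" if "x \<in> {1..?k}" for x
      proof -
        have "blowup d h (r * d + x) = blowup d ?h x"
          using that s by (intro blowup_shift[OF h r']) auto
        also have "\<dots> = blowup d (kth (?h ` {1..Suc p})) x"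
          using that s kth_image[OF embeddings_shift[OF h r']]
          by (intro blowup_cong[where m = p and s = s]) auto
        finally show ?thesis .
      qed
      then have "(\<lambda>x. blowup d h (r * d + x)) ` {1..?k} = blowup d (kth (?h ` {1..Suc p})) ` {1..?k}"
        by (intro image_cong) auto
      then show ?thesis
        using mono[OF r] by (simp add: c'_def)
    qed
    ultimately show "\<exists>j \<in> {1..t}. \<exists>f \<in> embeddings (e j * d + ?l) (M * d + s).
        \<forall>r < e j. c ((\<lambda>x. f (r * d + x)) ` {1..?k}) = j"
      using j by blast
  qed
qed

text \<open>The lower bound in contrapositive form: with \<open>M\<close> one below the least value
  for the paths of uniformity \<open>Suc p\<close>, the conclusion is absurd, so no
  \<open>N < M * d + s\<close> can work.\<close>

lemma arrows_thinning:
  assumes p: "1 \<le> p" and s: "1 \<le> s" "s \<le> d" and e: "\<And>j. j \<in> {1..t} \<Longrightarrow> 1 \<le> e j"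
    and N: "N < M * d + s"
    and arr: "arrows (p * d + s) t (\<lambda>j. path_hypergraph (p * d + s) ((p - 1) * d + s) (e j)) N"
  shows "arrows (Suc p) t (\<lambda>j. path_hypergraph (Suc p) p (e j)) M"
proof -
  let ?k = "p * d + s" and ?l = "(p - 1) * d + s"
  have kl: "?l < ?k" "?k - ?l = d"
    using p s by (cases p; simp)+
  have len: "e j * d + ?l = (e j + p - 1) * d + s" for j
    using p by (cases p) (auto simp: algebra_simps)
  have "\<exists>j \<in> {1..t}. \<exists>h \<in> embeddings (e j + p) M.
      \<forall>r < e j. c ((\<lambda>x. h (r + x)) ` {1..Suc p}) = j"
    if c: "c \<in> [{1..M}]\<^bsup>Suc p\<^esup> \<rightarrow> {1..t}" for c
  proof -
    define c' where "c' A = c (thinning d s (kth A) ` {1..Suc p})" for A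
    have "c' \<in> [{1..N}]\<^bsup>?k\<^esup> \<rightarrow> {1..t}"
    proof
      fix A assume "A \<in> [{1..N}]\<^bsup>?k\<^esup>"
      then have "thinning d s (kth A) ` {1..Suc p} \<in> [{1..M}]\<^bsup>Suc p\<^esup>"
        using s N by (intro embeddings_image thinning_embedding[where N = N] kth_embedding)
      then show "c' A \<in> {1..t}"
        using c by (auto simp: c'_def)
    qed
    then obtain j f where j: "j \<in> {1..t}" and f: "f \<in> embeddings (e j * d + ?l) N"
      and mono: "\<And>r. r < e j \<Longrightarrow> c' ((\<lambda>x. f (r * d + x)) ` {1..?k}) = j"
      using arr unfolding arrows_path_iff[OF kl(1)] kl(2) by blast
    have ej: "Suc (e j + p - 1) = e j + p"
      using e[OF j] by simp
    have "thinning d s f \<in> embeddings (Suc (e j + p - 1)) M"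
      using f N s unfolding len by (intro thinning_embedding)
    moreover have "c ((\<lambda>n. thinning d s f (r + n)) ` {1..Suc p}) = j" if r: "r < e j" for r
    proof -
      let ?f = "\<lambda>x. f (r * d + x)"
      have "Suc r * d \<le> e j * d"
        using r by (intro mult_le_mono1) simp
      moreover have "?k = d + ?l"
        using kl by linarith
      ultimately have r': "r * d + ?k \<le> e j * d + ?l"
        by simp
      have "thinning d s f (r + n) = thinning d s (kth (?f ` {1..?k})) n" if "n \<in> {1..Suc p}" for n
      proof -
        have "thinning d s f (r + n) = thinning d s ?f n"
          using that by (intro thinning_shift) auto
        also have "\<dots> = thinning d s (kth (?f ` {1..?k})) n"
          using that s kth_image[OF embeddings_shift[OF f r']]
          by (intro thinning_cong[where m = p]) auto
        finally show ?thesis .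
      qed
      then have "(\<lambda>n. thinning d s f (r + n)) ` {1..Suc p} =
          thinning d s (kth (?f ` {1..?k})) ` {1..Suc p}"
        by (intro image_cong) auto
      then show ?thesis
        using mono[OF r] by (simp add: c'_def)
    qed
    ultimately show ?thesis
      using j unfolding ej by blast
  qed
  then show ?thesis
    unfolding arrows_path_iff[OF lessI] by simp
qed

theorem theorem1:
  fixes k l i t :: nat and e :: "nat \<Rightarrow> nat"
  assumes "1 \<le> l" and "l < k"
    and "\<And>j. j \<in> {1..t} \<Longrightarrow> 1 \<le> e j"
    and "i = intersection_number k l"
  shows "int (ordered_ramsey k t (\<lambda>j. path_hypergraph k l (e j))) =
    (int k - int l) * int (ordered_ramsey i t (\<lambda>j. path_hypergraph i (i - 1) (e j)))
      + int l - (int k - int l) * (int i - 1)"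
proof -
  have "is_intersection_number k l i"
    unfolding assms(4) intersection_number_def
    by (rule theI'[OF ex1_intersection_number[OF assms(1,2)]])
  then have i: "2 \<le> i" "(i - 1) * (k - l) < k" "k \<le> i * (k - l)"
    using is_intersection_number_iff[OF assms(2)] by auto
  define d where "d = k - l"
  obtain p where p: "i = Suc p" "1 \<le> p"
    using i(1) by (cases i) auto
  \<comment> \<open>The bounds on \<open>i\<close> say \<open>p * d < k \<le> (p + 1) * d\<close>,
    so the remainder lies in \<open>{1..d}\<close>, with value \<open>d\<close> rather than 0 when
    \<open>d\<close> divides \<open>k\<close>.\<close>
  define s where "s = k - p * d"
  have s: "1 \<le> s" "s \<le> d" and k: "k = p * d + s"
    using i p by (auto simp: s_def d_def)
  have l: "l = (p - 1) * d + s"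
    using k p assms(2) unfolding d_def by (cases p) auto
  let ?P = "arrows k t (\<lambda>j. path_hypergraph k l (e j))"
  let ?Q = "arrows i t (\<lambda>j. path_hypergraph i p (e j))"
  have R: "ordered_ramsey k t (\<lambda>j. path_hypergraph k l (e j)) = Least ?P"
    "ordered_ramsey i t (\<lambda>j. path_hypergraph i (i - 1) (e j)) = Least ?Q"
    by (simp_all add: ordered_ramsey_def arrows_def[abs_def] p)
  have Q: "?Q (Least ?Q)"
    using LeastI_ex[OF arrows_path_exists[OF lessI]] unfolding p .
  have "\<not> ?Q 0"
    unfolding p by (rule arrows_path_nonzero[OF lessI assms(3)])
  \<comment> \<open>From here on \<open>M\<close> is one less than the Ramsey number, that is, the
    number of full blocks.\<close>
  with Q obtain M where M: "Least ?Q = Suc M"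
    by (cases "Least ?Q") auto
  have P: "Least ?P = M * d + s"
  proof (rule Least_equality)
    show "?P (M * d + s)"
      using arrows_blowup[of p s d t e M] Q s p assms(3) unfolding M k[symmetric] l[symmetric] by simp
    fix N assume "?P N"
    show "M * d + s \<le> N"
    proof (rule ccontr)
      assume "\<not> M * d + s \<le> N"
      then have "?Q M"
        using arrows_thinning[of p s d t e N M] \<open>?P N\<close> s p assms(3)
        unfolding k[symmetric] l[symmetric] by simp
      then show False
        using not_less_Least[of M ?Q] M by simp
    qed
  qed
  \<comment> \<open>With \<open>l = (p - 1) * d + s\<close> and \<open>i - 1 = p\<close>, the
    claimed value \<open>d * (M + 1) + l - d * p\<close> is \<open>M * d + s\<close>.\<close>
  have kl: "int k - int l = int d"
    using assms(2) by (simp add: d_def)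
  then have "int l = int d * (int p - 1) + int s"
    by (simp add: k algebra_simps)
  moreover have "int i = int p + 1"
    by (simp add: p)
  ultimately show ?thesis
    unfolding R P M kl by (simp add: algebra_simps)
qed

end
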